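(* Fix any agent $k$ and any (possibly adversarial) mapping from sequences of bids to sequences of allocations $x_{k,t}\in[0,1]$ and payments $p_{k,t}\ge 0$ such that $p_{k,t}\le b_{k,t}x_{k,t}$ for every round $t$. Assume $\eta_{k,R}\le\frac1{\overline v}$ and $\eta_{k,B}\le\min\{\frac1{\rho_k},\frac1{\overline v}\}$. Then the bidding algorithm described in the context satisfies $$\sum_{t=1}^Tv_{k,t}x_{k,t}\ \ge\ \gamma_k\sum_{t=1}^Tp_{k,t}\qquad\text{and}\qquad\sum_{t=1}^Tp_{k,t}\le B_k.$$
   Context: There are $T$ rounds. Agent $k$ has values $v_{k,t}\in[0,\overline v]$ (arbitrary), ROI parameter $\gamma_k\ge1$, and budget $B_k=\rho_kT$ with $\rho_k>0$. **Algorithm** (learning rates $\eta_{k,R},\eta_{k,B}>0$). Initialize $\mu^R_{k,1}=\gamma_k-1$ and $\mu^B_{k,1}=\overline v/\rho_k-1$. For $t=1,\dots,T$: set $\mu_{k,t}=\max\{\mu^R_{k,t},\mu^B_{k,t},0\}$; bid $b_{k,t}=v_{k,t}/(1+\mu_{k,t})$; receive allocation $x_{k,t}\in[0,1]$ and payment $p_{k,t}$; update $\mu^R_{k,t+1}=\mu^R_{k,t}+\eta_{k,R}(\gamma_kp_{k,t}-v_{k,t}x_{k,t})$ and $\mu^B_{k,t+1}=\mu^B_{k,t}+\eta_{k,B}(p_{k,t}-\rho_k)$. *)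

theory Defs
  imports Complex_Main
begin

text \<open>
  \<open>feasible_outcomes T k X P\<close>: the mappings \<open>X\<close> and \<open>P\<close> send every bid profile (a bid sequence
  for each agent) to the allocations and payments of agent \<open>k\<close> in rounds \<open>1, \<dots>, T\<close>. The other
  agents' bids are unconstrained, and the outcome of a round may depend on the whole profile.
  Negative bids of agent \<open>k\<close> are excluded, since they would force allocation and payment to be zero.
\<close>

definition feasible_outcomes ::
  "nat \<Rightarrow> 'k \<Rightarrow> (('k \<Rightarrow> nat \<Rightarrow> real) \<Rightarrow> nat \<Rightarrow> real) \<Rightarrow> (('k \<Rightarrow> nat \<Rightarrow> real) \<Rightarrow> nat \<Rightarrow> real) \<Rightarrow> bool"
where
  "feasible_outcomes T k X P \<longleftrightarrow>
     (\<forall>b. (\<forall>t\<in>{1..T}. 0 \<le> b k t) \<longrightarrow>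
        (\<forall>t\<in>{1..T}. 0 \<le> X b t \<and> X b t \<le> 1 \<and> 0 \<le> P b t \<and> P b t \<le> b k t * X b t))"

text \<open>
  \<open>algorithm_run T vbar \<gamma> \<rho> \<eta>R \<eta>B v b x p\<close>: facing allocations \<open>x\<close> and payments \<open>p\<close>, the
  algorithm of a single agent submits the bids \<open>b\<close> in rounds \<open>1, \<dots>, T\<close>. Stated as a relation,
  because \<open>x\<close> and \<open>p\<close> in turn depend on \<open>b\<close>. The multipliers are determined by the recursion
  up to index \<open>T + 1\<close>.
\<close>

definition algorithm_run ::
  "nat \<Rightarrow> real \<Rightarrow> real \<Rightarrow> real \<Rightarrow> real \<Rightarrow> real \<Rightarrow>
   (nat \<Rightarrow> real) \<Rightarrow> (nat \<Rightarrow> real) \<Rightarrow> (nat \<Rightarrow> real) \<Rightarrow> (nat \<Rightarrow> real) \<Rightarrow> bool"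
where
  "algorithm_run T vbar \<gamma> \<rho> \<eta>R \<eta>B v b x p \<longleftrightarrow>
     (\<exists>\<mu>R \<mu>B \<mu> :: nat \<Rightarrow> real.
        \<mu>R 1 = \<gamma> - 1 \<and> \<mu>B 1 = vbar / \<rho> - 1 \<and>
        (\<forall>t\<in>{1..T}.
           \<mu> t = max (max (\<mu>R t) (\<mu>B t)) 0 \<and>
           b t = v t / (1 + \<mu> t) \<and>
           \<mu>R (t + 1) = \<mu>R t + \<eta>R * (\<gamma> * p t - v t * x t) \<and>
           \<mu>B (t + 1) = \<mu>B t + \<eta>B * (p t - \<rho>)))"

end

theory Submission
  imports Defs
begin

text \<open>
  A multiplier never exceeds its initial value \<open>c - 1\<close>, where \<open>c = \<gamma>\<close> for the ROI constraint and
  \<open>c = vbar / \<rho>\<close> for the budget constraint. In both cases the increment is at most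
  \<open>a * (c / (1 + \<mu>) - 1)\<close> for some \<open>a \<in> [0, 1]\<close>: it can be positive only if \<open>1 + \<mu> < c\<close>, and then
  it is at most \<open>c - (1 + \<mu>)\<close>. As the multiplier after round \<open>T\<close> equals its initial value plus the
  learning rate times the accumulated constraint violation, that violation is nonpositive.
\<close>

lemma multiplier_step_le:
  fixes l m c a e :: real
  assumes "1 \<le> m" "1 + l \<le> m" "l \<le> c - 1" "0 \<le> a" "a \<le> 1" "e \<le> a * (c / m - 1)"
  shows "l + e \<le> c - 1"
proof (cases "c \<le> m")
  case True
  then have "c / m - 1 \<le> 0" using assms by (simp add: field_simps)
  then have "a * (c / m - 1) \<le> 0" using assms by (simp add: mult_nonneg_nonpos)
  then show ?thesis using assms by linarith
next
  case False
  then have "0 \<le> c / m - 1" using assms by (simp add: field_simps)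
  then have "a * (c / m - 1) \<le> c / m - 1" using assms by (simp add: mult_left_le_one_le)
  also have "\<dots> = (c - m) / m" using assms by (simp add: field_simps)
  also have "\<dots> \<le> c - m" using assms False by (simp add: divide_le_eq mult_le_cancel_left1)
  \<comment> \<open>Here \<open>m\<close> may exceed \<open>1 + l\<close>, since the bid uses the
    larger of both multipliers. This only helps: \<open>l + (c - m)\<close> is at most
    \<open>c - 1\<close> as soon as \<open>1 + l \<le> m\<close>.\<close>
  finally show ?thesis using assms by linarith
qed

text \<open>Telescoping turns a bound on the final multiplier into one on the total violation
  \<open>g\<close>. The bound is needed only as an invariant passed from each round to the
  next.\<close>

lemma sum_increments_nonpos:
  fixes l g :: "nat \<Rightarrow> real"
  assumes "0 < h"
    and step: "\<And>t. t \<in> {1..T} \<Longrightarrow> l (t + 1) = l t + h * g t"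
    and le: "\<And>t. t \<in> {1..T} \<Longrightarrow> l t \<le> l 1 \<Longrightarrow> l (t + 1) \<le> l 1"
  shows "(\<Sum>t = 1..T. g t) \<le> 0"
proof -
  \<comment> \<open>Index \<open>n + 1\<close> records rounds 1 to \<open>n\<close>, so
    \<open>n = T\<close> includes the last round's update.\<close>
  have "n \<le> T \<Longrightarrow> l (n + 1) = l 1 + h * (\<Sum>t = 1..n. g t) \<and> l (n + 1) \<le> l 1" for n
  proof (induction n)
    case (Suc n)
    then show ?case using step[of "Suc n"] le[of "Suc n"] by (simp add: algebra_simps)
  qed simp
  from this[of T] have "h * (\<Sum>t = 1..T. g t) \<le> 0" by simp
  then show ?thesis using \<open>0 < h\<close> by (simp add: mult_le_0_iff)
qed

theorem lemma6:
  fixes T :: nat and k :: 'k and vbar :: real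
    and \<gamma> \<rho> B \<eta>R \<eta>B :: "'k \<Rightarrow> real"
    and v b :: "'k \<Rightarrow> nat \<Rightarrow> real"
    and X P :: "('k \<Rightarrow> nat \<Rightarrow> real) \<Rightarrow> nat \<Rightarrow> real"
  assumes "0 < vbar"
    and "\<And>t. t \<in> {1..T} \<Longrightarrow> v k t \<in> {0..vbar}"
    and "1 \<le> \<gamma> k"
    and "0 < \<rho> k"
    and "B k = \<rho> k * real T"
    and "0 < \<eta>R k" and "\<eta>R k \<le> 1 / vbar"
    and "0 < \<eta>B k" and "\<eta>B k \<le> min (1 / \<rho> k) (1 / vbar)"
    and "feasible_outcomes T k X P"
    and "algorithm_run T vbar (\<gamma> k) (\<rho> k) (\<eta>R k) (\<eta>B k) (v k) (b k) (X b) (P b)"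
  shows "(\<Sum>t = 1..T. v k t * X b t) \<ge> \<gamma> k * (\<Sum>t = 1..T. P b t) \<and> (\<Sum>t = 1..T. P b t) \<le> B k"
proof -
  let ?v = "v k" and ?x = "X b" and ?p = "P b"
  have vb: "0 < vbar" and g1: "1 \<le> \<gamma> k" and r0: "0 < \<rho> k" and eR: "0 < \<eta>R k" and eB: "0 < \<eta>B k"
    using assms by auto
  have eR1: "\<eta>R k * vbar \<le> 1" and eB1: "\<eta>B k * \<rho> k \<le> 1"
    using assms by (simp_all add: pos_le_divide_eq)
  have v: "0 \<le> ?v t" "?v t \<le> vbar" if "t \<in> {1..T}" for t
    using assms(2)[OF that] by auto
  obtain \<mu>R \<mu>B \<mu> where R1: "\<mu>R 1 = \<gamma> k - 1" and B1: "\<mu>B 1 = vbar / \<rho> k - 1"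
    and run: "\<And>t. t \<in> {1..T} \<Longrightarrow> \<mu> t = max (max (\<mu>R t) (\<mu>B t)) 0 \<and>
           b k t = ?v t / (1 + \<mu> t) \<and>
           \<mu>R (t + 1) = \<mu>R t + \<eta>R k * (\<gamma> k * ?p t - ?v t * ?x t) \<and>
           \<mu>B (t + 1) = \<mu>B t + \<eta>B k * (?p t - \<rho> k)"
    using assms(11) unfolding algorithm_run_def by blast
  have mu: "0 \<le> \<mu> t" "\<mu>R t \<le> \<mu> t" "\<mu>B t \<le> \<mu> t" if "t \<in> {1..T}" for t
    using run[OF that] by auto
  \<comment> \<open>\<open>feasible_outcomes\<close> constrains outcomes only on profiles in which
    agent \<open>k\<close> bids nonnegatively.\<close>
  have "0 \<le> b k t" if "t \<in> {1..T}" for t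
    using run[OF that] v[OF that] mu[OF that] by simp
  then have feas: "0 \<le> ?x t" "?x t \<le> 1" "?p t \<le> b k t * ?x t" if "t \<in> {1..T}" for t
    using assms(10) that unfolding feasible_outcomes_def by blast+
  have p: "?p t \<le> ?v t * ?x t / (1 + \<mu> t)" if "t \<in> {1..T}" for t
    using feas(3)[OF that] run[OF that] by simp
  have vx: "0 \<le> ?v t * ?x t" "?v t * ?x t \<le> vbar" if "t \<in> {1..T}" for t
    using v[OF that] feas[OF that] mult_mono[of "?v t" vbar "?x t" 1] by auto
  have "(\<Sum>t = 1..T. \<gamma> k * ?p t - ?v t * ?x t) \<le> 0"
  proof (rule sum_increments_nonpos[of "\<eta>R k" _ \<mu>R])
    fix t assume t: "t \<in> {1..T}" and le: "\<mu>R t \<le> \<mu>R 1"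
    \<comment> \<open>Factoring the value won out of the ROI increment leaves
      \<open>\<gamma> k / (1 + \<mu> t) - 1\<close>. The weight is at most 1 because the value won
      is at most \<open>vbar\<close> and \<open>\<eta>R k \<le> 1 / vbar\<close>.\<close>
    let ?a = "\<eta>R k * (?v t * ?x t)"
    have "?a \<le> \<eta>R k * vbar" using vx[OF t] eR by simp
    then have a1: "?a \<le> 1" using eR1 by linarith
    have "\<gamma> k * ?p t \<le> \<gamma> k * (?v t * ?x t / (1 + \<mu> t))"
      using p[OF t] g1 by (intro mult_left_mono) auto
    then have "\<eta>R k * (\<gamma> k * ?p t - ?v t * ?x t)
        \<le> \<eta>R k * (\<gamma> k * (?v t * ?x t / (1 + \<mu> t)) - ?v t * ?x t)"
      using eR by simp
    also have "\<dots> = ?a * (\<gamma> k / (1 + \<mu> t) - 1)" by (simp add: algebra_simps)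
    finally have "\<mu>R t + \<eta>R k * (\<gamma> k * ?p t - ?v t * ?x t) \<le> \<gamma> k - 1"
      using mu[OF t] le R1 a1 vx[OF t] eR
      by (intro multiplier_step_le[of "1 + \<mu> t" _ _ ?a]) auto
    then show "\<mu>R (t + 1) \<le> \<mu>R 1" using run[OF t] R1 by simp
  qed (use eR run in auto)
  moreover have "(\<Sum>t = 1..T. ?p t - \<rho> k) \<le> 0"
  proof (rule sum_increments_nonpos[of "\<eta>B k" _ \<mu>B])
    fix t assume t: "t \<in> {1..T}" and le: "\<mu>B t \<le> \<mu>B 1"
    \<comment> \<open>For the budget, bounding the value won by \<open>vbar\<close> and factoring
      out \<open>\<rho> k\<close> gives \<open>c = vbar / \<rho> k\<close>, with the constant weight
      \<open>\<eta>B k * \<rho> k\<close>.\<close>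
    have "?v t * ?x t / (1 + \<mu> t) \<le> vbar / (1 + \<mu> t)"
      using vx[OF t] mu[OF t] by (intro divide_right_mono) auto
    then have "\<eta>B k * (?p t - \<rho> k) \<le> \<eta>B k * (vbar / (1 + \<mu> t) - \<rho> k)"
      using p[OF t] eB by (intro mult_left_mono) auto
    also have "\<dots> = \<eta>B k * \<rho> k * (vbar / \<rho> k / (1 + \<mu> t) - 1)"
      using r0 by (simp add: right_diff_distrib)
    finally have "\<mu>B t + \<eta>B k * (?p t - \<rho> k) \<le> vbar / \<rho> k - 1"
      using mu[OF t] le B1 eB1 eB r0
      by (intro multiplier_step_le[of "1 + \<mu> t" _ _ "\<eta>B k * \<rho> k"]) auto
    then show "\<mu>B (t + 1) \<le> \<mu>B 1" using run[OF t] B1 by simp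
  qed (use eB run in auto)
  ultimately show ?thesis
    using assms(5) by (simp add: sum_subtractf sum_distrib_left mult.commute)
qed

end
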